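(* There is an absolute constant $c>0$ such that the following holds. Let $n$ be a power of $2$, let $1\le d\le n$ and $\epsilon=d/n$. Then $$D^{lin,U}_{\frac{1-\sqrt\epsilon}{2}}(\mathrm{Add}_n)\ge d\qquad\text{and}\qquad D^{\rightarrow,U}_{c(1-\epsilon)/n}(\mathrm{Add}_n^+)\ge d.$$
   Context: The addressing function $\mathrm{Add}_n\colon\{0,1\}^{\log_2 n+n}\to\{0,1\}$ is $\mathrm{Add}_n(x,y_1,\dots,y_n)=y_x$ for $x\in\{0,1\}^{\log_2 n}$ interpreted as an index in $[n]$ and $y_i\in\{0,1\}$; inputs are viewed as elements of $\mathbb F_2^{N}$, $N=\log_2n+n$. $F^+(u,v)=F(u+v)$. $D^{lin,U}_\delta(F)$ is the smallest $k$ such that there are fixed $\alpha_1,\dots,\alpha_k\in\mathbb F_2^N$ and a function $g$ on $\mathbb F_2^k$ with $\Pr_{u\sim U(\mathbb F_2^N)}[g(\alpha_1\cdot u,\dots,\alpha_k\cdot u)=F(u)]\ge1-\delta$. For a two-party function $G$ on $\mathbb F_2^N\times\mathbb F_2^N$, $D^{\rightarrow,U}_\delta(G)$ is the smallest $t$ such that there are $M\colon\mathbb F_2^N\to\{0,1\}^t$ and $h\colon\{0,1\}^t\times\mathbb F_2^N\to\{0,1\}$ with $\Pr_{u,v}[h(M(u),v)=G(u,v)]\ge1-\delta$ for independent uniform $u,v$; the constant $c$ represents the paper's $\Theta(\cdot)$. *)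

theory Defs
  imports
    "HOL-Probability.Probability_Mass_Function"
    "HOL-Library.Z2"
    "HOL-Library.Discrete_Functions"
    "Jordan_Normal_Form.Matrix"
begin

(* Coordinates 0, ..., log2 n - 1 hold the address x (least significant bit first);
   coordinate log2 n + j holds y_{j+1}, so the address with binary value j selects y_{j+1}.
   floor_log is the exact base-2 logarithm on powers of two. *)

definition add_dim :: "nat \<Rightarrow> nat" where
  "add_dim n = floor_log n + n"

definition address :: "nat \<Rightarrow> bit Matrix.vec \<Rightarrow> nat" where
  "address n u = (\<Sum>i<floor_log n. if vec_index u i = 1 then 2 ^ i else 0)"

definition Add :: "nat \<Rightarrow> bit Matrix.vec \<Rightarrow> bit" where
  "Add n u = vec_index u (floor_log n + address n u)"

definition xor_fun :: "(bit Matrix.vec \<Rightarrow> bit) \<Rightarrow> bit Matrix.vec \<Rightarrow> bit Matrix.vec \<Rightarrow> bit" where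
  "xor_fun F u v = F (u + v)"

definition unif :: "nat \<Rightarrow> bit Matrix.vec pmf" where
  "unif N = pmf_of_set (carrier_vec N)"

definition linear_sketch :: "nat \<Rightarrow> real \<Rightarrow> (bit Matrix.vec \<Rightarrow> bit) \<Rightarrow> nat \<Rightarrow> bool" where
  "linear_sketch N \<delta> F k \<longleftrightarrow>
     (\<exists>(\<alpha> :: nat \<Rightarrow> bit Matrix.vec) (g :: bit Matrix.vec \<Rightarrow> bit).
        (\<forall>i<k. \<alpha> i \<in> carrier_vec N) \<and>
        measure_pmf.prob (unif N)
          {u. g (Matrix.vec k (\<lambda>i. scalar_prod (\<alpha> i) u)) = F u} \<ge> 1 - \<delta>)"

definition D_lin :: "nat \<Rightarrow> real \<Rightarrow> (bit Matrix.vec \<Rightarrow> bit) \<Rightarrow> nat" where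
  "D_lin N \<delta> F = (LEAST k. linear_sketch N \<delta> F k)"

definition one_way_protocol ::
  "nat \<Rightarrow> real \<Rightarrow> (bit Matrix.vec \<Rightarrow> bit Matrix.vec \<Rightarrow> bit) \<Rightarrow> nat \<Rightarrow> bool" where
  "one_way_protocol N \<delta> G t \<longleftrightarrow>
     (\<exists>(M :: bit Matrix.vec \<Rightarrow> bit Matrix.vec) (h :: bit Matrix.vec \<Rightarrow> bit Matrix.vec \<Rightarrow> bit).
        (\<forall>u \<in> carrier_vec N. M u \<in> carrier_vec t) \<and>
        measure_pmf.prob (pair_pmf (unif N) (unif N))
          {(u, v). h (M u) v = G u v} \<ge> 1 - \<delta>)"

definition D_oneway ::
  "nat \<Rightarrow> real \<Rightarrow> (bit Matrix.vec \<Rightarrow> bit Matrix.vec \<Rightarrow> bit) \<Rightarrow> nat" where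
  "D_oneway N \<delta> G = (LEAST t. one_way_protocol N \<delta> G t)"

(* For a nonnegative error parameter, both minima range over nonempty sets. *)

lemma finite_carrier_bit_vec: "finite (carrier_vec N :: bit Matrix.vec set)"
proof -
  have "(UNIV :: bit set) = {0, 1}" using bit.exhaust by auto
  then have f: "finite (UNIV :: bit set)" by (metis finite.emptyI finite.insertI)
  have "carrier_vec N \<subseteq> vec_of_list ` {xs :: bit list. set xs \<subseteq> UNIV \<and> length xs = N}"
  proof
    fix v :: "bit Matrix.vec" assume "v \<in> carrier_vec N"
    then have "v = vec_of_list (list_of_vec v)" "length (list_of_vec v) = N"
      by (auto simp: vec_list)
    then show "v \<in> vec_of_list ` {xs :: bit list. set xs \<subseteq> UNIV \<and> length xs = N}"
      by blast
  qed
  then show ?thesis using finite_lists_length_eq[OF f] finite_surj by blast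
qed

lemma set_pmf_unif: "set_pmf (unif N) = carrier_vec N"
  unfolding unif_def by (rule set_pmf_of_set) (auto simp: finite_carrier_bit_vec intro: zero_carrier_vec)

lemma linear_sketch_full:
  assumes "\<delta> \<ge> 0"
  shows "linear_sketch N \<delta> F N"
proof -
  have "Matrix.vec N (\<lambda>i. scalar_prod (unit_vec N i) u) = u" if "u \<in> carrier_vec N" for u :: "bit Matrix.vec"
    using that by (intro eq_vecI) (auto simp: scalar_prod_left_unit)
  then have "measure_pmf.prob (unif N)
      {u. F (Matrix.vec N (\<lambda>i. scalar_prod (unit_vec N i) u)) = F u} = 1"
    by (subst measure_pmf.prob_eq_1) (auto simp: AE_measure_pmf_iff set_pmf_unif)
  then show ?thesis using assms unfolding linear_sketch_def
    by (intro exI[of _ "unit_vec N"] exI[of _ F]) auto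
qed

lemma one_way_protocol_full:
  assumes "\<delta> \<ge> 0"
  shows "one_way_protocol N \<delta> G N"
  using assms unfolding one_way_protocol_def
  by (intro exI[of _ "\<lambda>u. u"] exI[of _ G]) auto

end

theory Submission imports Defs begin

unbundle no vec_syntax
unbundle no inner_syntax

text \<open>
  Split an input as $u = (x, y)$ with address $x$ and data $y$.

  Linear sketches: once $x$ is known, $k$ parities of $u$ are parities of $y$, and they are
  independent of the bit $y_j$ unless the unit vector $e_j$ lies in their span. This happens for at
  most $k$ of the $n$ addresses, so the success probability is at most $(1 + k/n)/2$, which is
  below $(1 + \sqrt{d/n})/2$ if $k < d$.

  One-way protocols: fix Alice's address $x$ and Bob's data $y'$. If Bob answers correctly for all
  of his addresses $x'$, then the message determines Alice's data $y$. Hence a message of $t < n$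
  bits leaves at least half of the $y$ with an error for at least one of the $n$ choices of
  $x'$, and the error probability is at least $1/(2n)$.
\<close>

section \<open>Bit vectors, supports and binary addresses\<close>

lemma sum_if_eq_set_encode:
  "finite A \<Longrightarrow> (\<Sum>i\<in>A. if P i then 2 ^ i else 0) = set_encode {i \<in> A. P i}"
  by (simp add: set_encode_def sum.inter_filter)

lemma set_encode_less_power2:
  assumes "A \<subseteq> {..<m}"
  shows "set_encode A < 2 ^ m"
proof -
  have "set_encode A \<le> (\<Sum>i<m. 2 ^ i)"
    unfolding set_encode_def using assms by (intro sum_mono2) auto
  also have "\<dots> < 2 ^ m"
    by (induction m) auto
  finally show ?thesis .
qed

text \<open>Identifying a vector with its support yields both the number of bit vectors and, through
  \<open>set_encode\<close>, the injectivity of addresses.\<close>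

lemma bij_betw_bit_vec_support:
  "bij_betw (\<lambda>u :: bit Matrix.vec. {i \<in> {..<n}. u $ i = 1}) (carrier_vec n) (Pow {..<n})"
proof (rule bij_betw_byWitness[where f' = "\<lambda>A. Matrix.vec n (\<lambda>i. if i \<in> A then 1 else 0)"])
  show "\<forall>u\<in>carrier_vec n. Matrix.vec n (\<lambda>i. if i \<in> {i \<in> {..<n}. u $ i = 1} then 1 else 0)
      = (u :: bit Matrix.vec)"
    by (auto intro!: eq_vecI)
qed (auto split: if_splits)

lemma card_carrier_bit_vec: "card (carrier_vec n :: bit Matrix.vec set) = 2 ^ n"
  using bij_betw_same_card[OF bij_betw_bit_vec_support, of n] by (simp add: card_Pow)

lemma bit_vec_add_self: "v \<in> carrier_vec n \<Longrightarrow> v + v = (0\<^sub>v n :: bit Matrix.vec)"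
  by (auto intro!: eq_vecI)

lemma bit_vec_add_cancel:
  fixes v w :: "bit Matrix.vec"
  assumes "v \<in> carrier_vec n" "w \<in> carrier_vec n"
  shows "v + w + w = v"
  using assms by (simp add: assoc_add_vec bit_vec_add_self)

lemma bij_betw_append_vec:
  "bij_betw (\<lambda>(x, y). x @\<^sub>v y) (carrier_vec m \<times> carrier_vec n) (carrier_vec (m + n))"
  by (rule bij_betw_byWitness[where f' = "\<lambda>u. (vec_first u m, vec_last u n)"])
    (auto simp: vec_first_def vec_last_def intro!: eq_vecI)

text \<open>The address is the binary code of the support, hence injective, and it stays below
  \<open>2 ^ m\<close>; equal cardinalities then give surjectivity.\<close>

lemma bij_betw_address:
  "bij_betw (address (2 ^ m)) (carrier_vec m) {..<2 ^ m}"
proof -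
  have eq: "address (2 ^ m) x = set_encode {i \<in> {..<m}. x $ i = 1}" for x
    unfolding address_def by (simp add: sum_if_eq_set_encode)
  have inj: "inj_on (address (2 ^ m)) (carrier_vec m)"
    unfolding eq using bij_betw_bit_vec_support[of m]
    by (auto simp: inj_on_def bij_betw_def set_encode_eq)
  moreover have "address (2 ^ m) ` carrier_vec m \<subseteq> {..<2 ^ m}"
    by (auto simp: eq intro!: set_encode_less_power2)
  moreover have "card (address (2 ^ m) ` carrier_vec m) = card {..<(2::nat) ^ m}"
    using card_image[OF inj] by (simp add: card_carrier_bit_vec)
  ultimately show ?thesis
    unfolding bij_betw_def by (intro conjI card_subset_eq) auto
qed

lemma address_append_vec:
  assumes "x \<in> carrier_vec m"
  shows "address (2 ^ m) (x @\<^sub>v y) = address (2 ^ m) x"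
  using assms unfolding address_def by (intro sum.cong) auto

lemma Add_append_vec:
  assumes "x \<in> carrier_vec m" "y \<in> carrier_vec (2 ^ m)"
  shows "Add (2 ^ m) (x @\<^sub>v y) = y $ address (2 ^ m) x"
proof -
  have "address (2 ^ m) x < 2 ^ m"
    using bij_betw_address[of m] assms(1) by (auto simp: bij_betw_def)
  then show ?thesis
    using assms by (simp add: Add_def address_append_vec)
qed

text \<open>Slicing by the first block lets bounds for one fixed address be summed over all
  addresses.\<close>

lemma card_append_vec_filter:
  "card {u \<in> carrier_vec (m + n). P u} =
    (\<Sum>x\<in>carrier_vec m. card {y \<in> carrier_vec n. P (x @\<^sub>v y)})"
  for P :: "bit Matrix.vec \<Rightarrow> bool"
proof -
  have "bij_betw (\<lambda>(x, y). x @\<^sub>v y)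
      (SIGMA x:carrier_vec m. {y \<in> carrier_vec n. P (x @\<^sub>v y)}) {u \<in> carrier_vec (m + n). P u}"
  proof (rule bij_betw_subset[OF bij_betw_append_vec])
    show "(\<lambda>(x, y). x @\<^sub>v y) ` (SIGMA x:carrier_vec m. {y \<in> carrier_vec n. P (x @\<^sub>v y)})
        = {u \<in> carrier_vec (m + n). P u}" (is "_ ` ?A = ?B")
    proof (rule equalityI[OF _ subsetI])
      fix u assume u: "u \<in> ?B"
      then have "u = vec_first u m @\<^sub>v vec_last u n"
        by simp
      with u show "u \<in> (\<lambda>(x, y). x @\<^sub>v y) ` ?A"
        by (intro image_eqI[where x = "(vec_first u m, vec_last u n)"]) auto
    qed auto
  qed auto
  from bij_betw_same_card[OF this, symmetric] show ?thesis
    by (simp add: finite_carrier_bit_vec)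
qed

section \<open>Linear sketches: counting correctly answered inputs\<close>

text \<open>The counted coordinates are those whose unit vector lies in the span of the parities. A
  pigeonhole argument replaces dimension theory: with more than \<open>k\<close> of them, two
  different subsets would have indicator vectors with the same \<open>k\<close> parities, and the
  sum of these vectors lies in the kernel.\<close>

lemma card_coordinates_determined_by_parities:
  fixes \<beta> :: "nat \<Rightarrow> bit Matrix.vec"
  assumes \<beta>: "\<And>i. i < k \<Longrightarrow> \<beta> i \<in> carrier_vec n"
  shows "card {j. j < n \<and> (\<forall>w\<in>carrier_vec n. (\<forall>i<k. \<beta> i \<bullet> w = 0) \<longrightarrow> w $ j = 0)} \<le> k"
    (is "card ?J \<le> k")
proof (rule ccontr)
  assume "\<not> card ?J \<le> k"
  define f where "f A = Matrix.vec k (\<lambda>i. \<beta> i \<bullet> Matrix.vec n (\<lambda>j. if j \<in> A then 1 else 0))" for A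
  have "card (f ` Pow ?J) \<le> card (carrier_vec k :: bit Matrix.vec set)"
    by (intro card_mono finite_carrier_bit_vec) (auto simp: f_def)
  also have "\<dots> < card (Pow ?J)"
    using \<open>\<not> card ?J \<le> k\<close> by (simp add: card_carrier_bit_vec card_Pow)
  finally have "\<not> inj_on f (Pow ?J)"
    by (rule pigeonhole)
  then obtain A B where AB: "A \<subseteq> ?J" "B \<subseteq> ?J" "f A = f B" "A \<noteq> B"
    by (auto simp: inj_on_def)
  define a b :: "bit Matrix.vec"
    where "a = Matrix.vec n (\<lambda>j. if j \<in> A then 1 else 0)"
      and "b = Matrix.vec n (\<lambda>j. if j \<in> B then 1 else 0)"
  have ab: "a \<in> carrier_vec n" "b \<in> carrier_vec n"
    by (auto simp: a_def b_def)
  have ker: "\<beta> i \<bullet> (a + b) = 0" if "i < k" for i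
  proof -
    have "f A $ i = f B $ i"
      using AB(3) by simp
    then have "\<beta> i \<bullet> a = \<beta> i \<bullet> b"
      using that by (simp add: f_def a_def b_def)
    then show ?thesis
      using scalar_prod_add_distrib[OF \<beta>[OF that] ab] by simp
  qed
  \<comment> \<open>A coordinate in the symmetric difference of \<open>A\<close> and
    \<open>B\<close>: there \<open>a + b\<close> is 1, although membership in the set forces 0 on
    the kernel.\<close>
  obtain j where j: "j \<in> ?J" "j \<in> A \<longleftrightarrow> j \<notin> B"
    using AB by blast
  have "a + b \<in> carrier_vec n"
    using ab by simp
  with j(1) ker have "(a + b) $ j = 0"
    by simp
  moreover have "(a + b) $ j = 1"
    using j by (auto simp: a_def b_def)
  ultimately show False
    by simp
qed

text \<open>Translation by \<open>w\<close> is an involution that exchanges agreement and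
  disagreement of \<open>f\<close> and \<open>b\<close>.\<close>

lemma card_half_of_flip:
  fixes f b :: "bit Matrix.vec \<Rightarrow> bit"
  assumes w: "w \<in> carrier_vec n"
    and f: "\<And>y. y \<in> carrier_vec n \<Longrightarrow> f (y + w) = f y"
    and b: "\<And>y. y \<in> carrier_vec n \<Longrightarrow> b (y + w) = b y + 1"
  shows "2 * card {y \<in> carrier_vec n. f y = b y} = 2 ^ n"
proof -
  have neq: "a \<noteq> c \<longleftrightarrow> a = c + 1" for a c :: bit
    by (cases a; cases c) auto
  have "bij_betw (\<lambda>y. y + w) {y \<in> carrier_vec n. f y = b y} {y \<in> carrier_vec n. f y \<noteq> b y}"
    using w by (intro bij_betw_byWitness[where f' = "\<lambda>y. y + w"])
      (auto simp: f b neq bit_vec_add_cancel simp del: add_bit_eq_xor)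
  then have "2 * card {y \<in> carrier_vec n. f y = b y} =
      card {y \<in> carrier_vec n. f y = b y} + card {y \<in> carrier_vec n. f y \<noteq> b y}"
    by (simp add: bij_betw_same_card)
  also have "\<dots> = card ({y \<in> carrier_vec n. f y = b y} \<union> {y \<in> carrier_vec n. f y \<noteq> b y})"
    by (rule card_Un_disjoint[symmetric]) (auto simp: finite_carrier_bit_vec)
  also have "{y \<in> carrier_vec n. f y = b y} \<union> {y \<in> carrier_vec n. f y \<noteq> b y} = carrier_vec n"
    by auto
  finally show ?thesis
    by (simp add: card_carrier_bit_vec)
qed

text \<open>An address whose bit is determined by the parities contributes at most
  \<open>2 ^ n\<close> correct data vectors, any other address exactly half of that. The first case
  covers at most \<open>k\<close> of the \<open>n\<close> addresses.\<close>

lemma card_linear_sketch_Add_correct: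
  fixes \<alpha> :: "nat \<Rightarrow> bit Matrix.vec"
  assumes n: "n = 2 ^ m" and \<alpha>: "\<And>i. i < k \<Longrightarrow> \<alpha> i \<in> carrier_vec (m + n)"
  shows "2 * card {u \<in> carrier_vec (m + n). g (Matrix.vec k (\<lambda>i. \<alpha> i \<bullet> u)) = Add n u}
    \<le> 2 ^ n * (n + k)"
proof -
  \<comment> \<open>For a fixed address the first block adds only a constant to each parity, so only
    the data part matters.\<close>
  define \<beta> where "\<beta> i = vec_last (\<alpha> i) n" for i
  define J where "J = {j. j < n \<and> (\<forall>w\<in>carrier_vec n. (\<forall>i<k. \<beta> i \<bullet> w = 0) \<longrightarrow> w $ j = 0)}"
  have J: "card J \<le> k"
    unfolding J_def by (rule card_coordinates_determined_by_parities) (simp add: \<beta>_def)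
  define X where "X = {x \<in> carrier_vec m. address n x \<in> J}"
  have "card X \<le> card J"
    using bij_betw_address[of m]
    by (intro card_inj_on_le[of "address n"])
       (auto simp: X_def J_def n bij_betw_def inj_on_def)
  with J have X: "card X \<le> k" by simp
  let ?S = "\<lambda>x. {y \<in> carrier_vec n. g (Matrix.vec k (\<lambda>i. \<alpha> i \<bullet> (x @\<^sub>v y))) = Add n (x @\<^sub>v y)}"
  have S: "2 * card (?S x) \<le> 2 ^ n + (if x \<in> X then 2 ^ n else 0)" if x: "x \<in> carrier_vec m" for x
  proof (cases "x \<in> X")
    case True
    have "card (?S x) \<le> card (carrier_vec n :: bit Matrix.vec set)"
      by (intro card_mono finite_carrier_bit_vec) auto
    then show ?thesis
      using True by (simp add: card_carrier_bit_vec)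
  next
    case False
    have lt: "address n x < n"
      using bij_betw_address[of m] x n by (auto simp: bij_betw_def)
    \<comment> \<open>An undetermined bit can be flipped by a data vector \<open>w\<close> that no
      parity notices; over bits, nonzero means 1.\<close>
    with False x obtain w where w: "w \<in> carrier_vec n" "w $ address n x = 1"
      and ker: "\<And>i. i < k \<Longrightarrow> \<beta> i \<bullet> w = 0"
      by (auto simp: X_def J_def)
    have "\<alpha> i \<bullet> (x @\<^sub>v (y + w)) = \<alpha> i \<bullet> (x @\<^sub>v y)" if "i < k" "y \<in> carrier_vec n" for i y
    proof -
      have "x @\<^sub>v (y + w) = (x @\<^sub>v y) + (0\<^sub>v m @\<^sub>v w)"
        using x that w by (subst append_vec_add[of _ m _ _ n]) auto
      then have "\<alpha> i \<bullet> (x @\<^sub>v (y + w)) = \<alpha> i \<bullet> (x @\<^sub>v y) + \<alpha> i \<bullet> (0\<^sub>v m @\<^sub>v w)"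
        using x that w \<alpha>[of i] by (simp add: scalar_prod_add_distrib[of _ "m + n"])
      also have "\<alpha> i \<bullet> (0\<^sub>v m @\<^sub>v w) = (vec_first (\<alpha> i) m @\<^sub>v \<beta> i) \<bullet> (0\<^sub>v m @\<^sub>v w)"
        using \<alpha>[OF that(1)] by (simp add: \<beta>_def)
      also have "\<dots> = 0"
        using w ker[OF that(1)] by (subst scalar_prod_append[of _ m _ n]) (auto simp: \<beta>_def)
      finally show ?thesis by simp
    qed
    then have "Matrix.vec k (\<lambda>i. \<alpha> i \<bullet> (x @\<^sub>v (y + w))) = Matrix.vec k (\<lambda>i. \<alpha> i \<bullet> (x @\<^sub>v y))"
      if "y \<in> carrier_vec n" for y
      using that by (intro eq_vecI) auto
    moreover have "Add n (x @\<^sub>v (y + w)) = Add n (x @\<^sub>v y) + 1" if "y \<in> carrier_vec n" for y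
      using x w that lt by (simp add: n Add_append_vec)
    ultimately have "2 * card (?S x) = 2 ^ n"
      using w by (intro card_half_of_flip[of w]) auto
    then show ?thesis by simp
  qed
  have "2 * card {u \<in> carrier_vec (m + n). g (Matrix.vec k (\<lambda>i. \<alpha> i \<bullet> u)) = Add n u}
      = (\<Sum>x\<in>carrier_vec m. 2 * card (?S x))"
    by (simp add: card_append_vec_filter sum_distrib_left)
  also have "\<dots> \<le> (\<Sum>x\<in>carrier_vec m. 2 ^ n + (if x \<in> X then 2 ^ n else 0))"
    by (rule sum_mono) (rule S)
  also have "\<dots> = 2 ^ n * (n + card X)"
    by (simp add: sum.distrib card_carrier_bit_vec n X_def sum.inter_filter[symmetric]
        finite_carrier_bit_vec algebra_simps)
  also have "\<dots> \<le> 2 ^ n * (n + k)"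
    using X by simp
  finally show ?thesis .
qed

lemma carrier_vec_nonempty: "carrier_vec N \<noteq> ({} :: bit Matrix.vec set)"
  using zero_carrier_vec by blast

lemma linear_sketch_Add_error:
  assumes n: "n = 2 ^ m" and sk: "linear_sketch (add_dim n) \<delta> (Add n) k"
  shows "1 - \<delta> \<le> (1 + real k / real n) / 2"
proof -
  have N: "add_dim n = m + n"
    by (simp add: add_dim_def n)
  obtain \<alpha> g where \<alpha>: "\<And>i. i < k \<Longrightarrow> \<alpha> i \<in> carrier_vec (m + n)"
    and p: "1 - \<delta> \<le> measure_pmf.prob (unif (m + n))
      {u. g (Matrix.vec k (\<lambda>i. \<alpha> i \<bullet> u)) = Add n u}"
    using sk unfolding linear_sketch_def N by blast
  let ?S = "{u \<in> carrier_vec (m + n). g (Matrix.vec k (\<lambda>i. \<alpha> i \<bullet> u)) = Add n u}"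
  have "real (2 * card ?S) \<le> real (2 ^ n * (n + k))"
    using n \<alpha> by (intro of_nat_mono card_linear_sketch_Add_correct)
  then have le: "2 * real (card ?S) \<le> 2 ^ n * (real n + real k)"
    by simp
  have "measure_pmf.prob (unif (m + n)) {u. g (Matrix.vec k (\<lambda>i. \<alpha> i \<bullet> u)) = Add n u}
      = real (card ?S) / (real n * 2 ^ n)"
    unfolding unif_def
    by (subst measure_pmf_of_set[OF carrier_vec_nonempty finite_carrier_bit_vec])
      (simp add: card_carrier_bit_vec power_add n Int_def)
  also have "\<dots> \<le> (1 + real k / real n) / 2"
    using le n by (simp add: field_simps)
  finally show ?thesis
    using p by simp
qed

section \<open>One-way protocols: counting errors\<close>

text \<open>With Alice holding \<open>(x, y)\<close> and Bob \<open>(x', y')\<close>, fix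
  \<open>x\<close> and \<open>y'\<close>. The message is injective on those \<open>y\<close> for
  which no \<open>x'\<close> errs, so at least half of the \<open>y\<close> have an erring
  \<open>x'\<close>. Each such triple \<open>(x, y', y)\<close> yields an error pair of its
  own.\<close>

lemma card_one_way_Add_error:
  fixes M :: "bit Matrix.vec \<Rightarrow> bit Matrix.vec"
  assumes n: "n = 2 ^ m" and t: "t < n"
    and M: "\<And>u. u \<in> carrier_vec (m + n) \<Longrightarrow> M u \<in> carrier_vec t"
  shows "n * 2 ^ n * 2 ^ n \<le> 2 * card {(u, v) \<in> carrier_vec (m + n) \<times> carrier_vec (m + n).
      h (M u) v \<noteq> Add n (u + v)}"
    (is "_ \<le> 2 * card ?E")
proof -
  let ?X = "carrier_vec m :: bit Matrix.vec set" and ?Y = "carrier_vec n :: bit Matrix.vec set"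
  define err where "err x y x' y' \<longleftrightarrow>
    h (M (x @\<^sub>v y)) (x' @\<^sub>v y') \<noteq> Add n ((x @\<^sub>v y) + (x' @\<^sub>v y'))" for x y x' y'
  define Bad where "Bad = (\<lambda>(x, y'). {y \<in> ?Y. \<exists>x'\<in>?X. err x y x' y'})"
  have Bad: "2 ^ n \<le> 2 * card (Bad (x, y'))" if x: "x \<in> ?X" and y': "y' \<in> ?Y" for x y'
  proof -
    let ?G = "?Y - Bad (x, y')"
    have "inj_on (\<lambda>y. M (x @\<^sub>v y)) ?G"
    proof (rule inj_onI)
      fix y z assume y: "y \<in> ?G" and z: "z \<in> ?G" and eq: "M (x @\<^sub>v y) = M (x @\<^sub>v z)"
      have "y $ j = z $ j" if j: "j < n" for j
      proof -
        \<comment> \<open>Bob's address will be \<open>x + s\<close>: adding Alice's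
          \<open>x\<close> leaves \<open>s\<close>, so the function reads bit \<open>j\<close> of
          the summed data.\<close>
        obtain s where s: "s \<in> ?X" "address n s = j"
          using bij_betw_address[of m] j n unfolding bij_betw_def by (metis imageE lessThan_iff)
        have sum: "(x @\<^sub>v r) + ((x + s) @\<^sub>v y') = s @\<^sub>v (r + y')" if "r \<in> ?Y" for r
        proof -
          have "x + (x + s) = s"
            using x s(1) bit_vec_add_cancel[of s m x] by (simp add: comm_add_vec[of _ m])
          then show ?thesis
            using x y' s(1) that by (simp add: append_vec_add[of _ m _ _ n])
        qed
        have xs: "x + s \<in> ?X"
          using x s(1) by simp
        have "\<not> err x y (x + s) y'" "\<not> err x z (x + s) y'"
          using y z xs by (auto simp: Bad_def)
        \<comment> \<open>Equal messages and the same input for Bob give equal answers, and both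
          answers are correct.\<close>
        then have "Add n (s @\<^sub>v (y + y')) = Add n (s @\<^sub>v (z + y'))"
          using y z eq by (simp add: err_def sum)
        then show ?thesis
          using y z y' s j by (simp add: n Add_append_vec del: add_bit_eq_xor)
      qed
      then show "y = z"
        using y z by (intro eq_vecI) auto
    qed
    then have "card ?G \<le> card (carrier_vec t :: bit Matrix.vec set)"
      using x M by (intro card_inj_on_le[of "\<lambda>y. M (x @\<^sub>v y)"]) (auto simp: finite_carrier_bit_vec)
    moreover have "card ?G = card ?Y - card (Bad (x, y'))"
      by (intro card_Diff_subset) (auto simp: Bad_def intro: finite_subset[OF _ finite_carrier_bit_vec])
    \<comment> \<open>Since \<open>t < n\<close>, the messages number at most half of the data
      vectors.\<close>
    moreover have "2 * 2 ^ t \<le> (2 :: nat) ^ n"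
      using power_increasing[of "Suc t" n "2 :: nat"] t by simp
    ultimately show ?thesis
      by (simp add: card_carrier_bit_vec)
  qed
  \<comment> \<open>One erring address of Bob is chosen for each bad triple; the value matters only
    on \<open>Bad\<close>.\<close>
  define s where "s x y y' = (SOME x'. x' \<in> ?X \<and> err x y x' y')" for x y y'
  have s: "s x y y' \<in> ?X \<and> err x y (s x y y') y'" if "y \<in> Bad (x, y')" for x y y'
    unfolding s_def by (rule someI_ex) (use that in \<open>auto simp: Bad_def\<close>)
  let ?B = "SIGMA p:?X \<times> ?Y. Bad p"
  have fE: "finite ?E"
    by (rule finite_subset[of _ "carrier_vec (m + n) \<times> carrier_vec (m + n)"])
      (auto simp: finite_carrier_bit_vec)
  have "card ?B \<le> card ?E"
  proof (rule card_inj_on_le[OF _ _ fE])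
    \<comment> \<open>The image pair still displays \<open>x\<close>, \<open>y\<close> and
      \<open>y'\<close>, so injectivity does not depend on the choice of \<open>s\<close>.\<close>
    show "inj_on (\<lambda>((x, y'), y). (x @\<^sub>v y, s x y y' @\<^sub>v y')) ?B"
    proof (rule inj_onI, clarify)
      fix x1 y1' y1 x2 y2' y2
      assume 1: "y1 \<in> Bad (x1, y1')" "x1 \<in> ?X" and 2: "y2 \<in> Bad (x2, y2')" "x2 \<in> ?X"
        and eq: "x1 @\<^sub>v y1 = x2 @\<^sub>v y2" "s x1 y1 y1' @\<^sub>v y1' = s x2 y2 y2' @\<^sub>v y2'"
      show "((x1, y1') = (x2, y2')) \<and> y1 = y2"
        using append_vec_eq[OF 1(2) 2(2)] eq
          append_vec_eq[OF conjunct1[OF s[OF 1(1)]] conjunct1[OF s[OF 2(1)]]]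
        by metis
    qed
    show "(\<lambda>((x, y'), y). (x @\<^sub>v y, s x y y' @\<^sub>v y')) ` ?B \<subseteq> ?E"
      using s by (fastforce simp: err_def Bad_def)
  qed
  moreover have "card ?B = (\<Sum>p\<in>?X \<times> ?Y. card (Bad p))"
    by (intro card_SigmaI) (auto simp: finite_carrier_bit_vec Bad_def)
  moreover have "(\<Sum>p\<in>?X \<times> ?Y. 2 ^ n) \<le> (\<Sum>p\<in>?X \<times> ?Y. 2 * card (Bad p))"
    by (rule sum_mono) (use Bad in auto)
  moreover have "(\<Sum>p\<in>?X \<times> ?Y. (2 :: nat) ^ n) = n * 2 ^ n * 2 ^ n"
    by (simp add: card_cartesian_product card_carrier_bit_vec n)
  ultimately show ?thesis
    by (simp add: sum_distrib_left[symmetric])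
qed

lemma pair_pmf_of_set:
  assumes "finite A" "A \<noteq> {}" "finite B" "B \<noteq> {}"
  shows "pair_pmf (pmf_of_set A) (pmf_of_set B) = pmf_of_set (A \<times> B)"
  using assms by (intro pmf_eqI) (clarsimp simp only: pmf_pair split_paired_all,
    simp add: pmf_of_set indicator_def card_cartesian_product)

text \<open>At least \<open>n * 2 ^ n * 2 ^ n / 2\<close> of the \<open>(n * 2 ^ n) ^ 2\<close>
  input pairs are errors.\<close>

lemma one_way_protocol_Add_error:
  assumes n: "n = 2 ^ m" and t: "t < n"
    and prot: "one_way_protocol (add_dim n) \<delta> (xor_fun (Add n)) t"
  shows "1 / (2 * real n) \<le> \<delta>"
proof -
  have N: "add_dim n = m + n"
    by (simp add: add_dim_def n)
  let ?C = "carrier_vec (m + n) :: bit Matrix.vec set"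
  obtain M :: "bit Matrix.vec \<Rightarrow> bit Matrix.vec" and h where M: "\<And>u. u \<in> ?C \<Longrightarrow> M u \<in> carrier_vec t"
    and p: "1 - \<delta> \<le> measure_pmf.prob (pair_pmf (unif (m + n)) (unif (m + n)))
      {(u, v). h (M u) v = Add n (u + v)}"
    using prot unfolding one_way_protocol_def N xor_fun_def by blast
  let ?S = "{(u, v). h (M u) v = Add n (u + v)}"
  let ?E = "{(u, v) \<in> ?C \<times> ?C. h (M u) v \<noteq> Add n (u + v)}"
  have E: "n * 2 ^ n * 2 ^ n \<le> 2 * card ?E"
    using n t M by (rule card_one_way_Add_error)
  have "- ?S \<inter> ?C \<times> ?C = ?E"
    by auto
  then have "measure_pmf.prob (pair_pmf (unif (m + n)) (unif (m + n))) (- ?S)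
      = real (card ?E) / (real n * 2 ^ n)\<^sup>2"
    unfolding unif_def pair_pmf_of_set[OF finite_carrier_bit_vec carrier_vec_nonempty
        finite_carrier_bit_vec carrier_vec_nonempty]
    by (subst measure_pmf_of_set)
      (auto simp: carrier_vec_nonempty finite_carrier_bit_vec card_cartesian_product
        card_carrier_bit_vec power_add n power2_eq_square Int_commute)
  moreover have "real (n * 2 ^ n * 2 ^ n) \<le> real (2 * card ?E)"
    using E of_nat_le_iff by blast
  then have "1 / (2 * real n) \<le> real (card ?E) / (real n * 2 ^ n)\<^sup>2"
    using n by (simp add: field_simps power2_eq_square)
  ultimately have "1 / (2 * real n) \<le>
      measure_pmf.prob (pair_pmf (unif (m + n)) (unif (m + n))) (- ?S)"
    by simp
  also have "\<dots> = 1 - measure_pmf.prob (pair_pmf (unif (m + n)) (unif (m + n))) ?S"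
    using measure_pmf.prob_compl[of ?S "pair_pmf (unif (m + n)) (unif (m + n))"]
    by (simp add: Compl_eq_Diff_UNIV)
  finally show ?thesis
    using p by simp
qed

theorem theorem4p7:
  "\<exists>c::real. c > 0 \<and>
     (\<forall>n d :: nat. (\<exists>m. n = 2 ^ m) \<longrightarrow> 1 \<le> d \<longrightarrow> d \<le> n \<longrightarrow>
        (let \<epsilon> = real d / real n in
           D_lin (add_dim n) ((1 - sqrt \<epsilon>) / 2) (Add n) \<ge> d \<and>
           D_oneway (add_dim n) (c * (1 - \<epsilon>) / real n) (xor_fun (Add n)) \<ge> d))"
proof -
  have "d \<le> D_lin (add_dim n) ((1 - sqrt (real d / real n)) / 2) (Add n) \<and>
      d \<le> D_oneway (add_dim n) (1 / 4 * (1 - real d / real n) / real n) (xor_fun (Add n))"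
    if n: "n = 2 ^ m" and d: "1 \<le> d" "d \<le> n" for n d m :: nat
  proof
    define \<epsilon> where "\<epsilon> = real d / real n"
    have \<epsilon>: "0 < \<epsilon>" "\<epsilon> \<le> 1"
      using d by (auto simp: \<epsilon>_def)
    \<comment> \<open>The error parameter is nonnegative because \<epsilon> \<le> 1, so the minimum
      is attained.\<close>
    have "linear_sketch (add_dim n) ((1 - sqrt \<epsilon>) / 2) (Add n)
        (D_lin (add_dim n) ((1 - sqrt \<epsilon>) / 2) (Add n))" (is "linear_sketch _ _ _ ?k")
      unfolding D_lin_def using \<epsilon> by (intro LeastI[OF linear_sketch_full]) simp
    from linear_sketch_Add_error[OF n this] have "sqrt \<epsilon> \<le> real ?k / real n"
      by (simp add: field_simps)
    \<comment> \<open>The counting bound gives sketch size at least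
      \<open>n * sqrt \<epsilon>\<close>; this inequality weakens it to
      \<open>n * \<epsilon> = d\<close>.\<close>
    moreover have "\<epsilon> \<le> sqrt \<epsilon>"
      using \<epsilon> by (intro real_le_rsqrt) (simp add: power2_eq_square mult_left_le)
    ultimately have "\<epsilon> \<le> real ?k / real n"
      by linarith
    then show "d \<le> D_lin (add_dim n) ((1 - sqrt (real d / real n)) / 2) (Add n)"
      using d by (simp add: \<epsilon>_def field_simps)
    have "one_way_protocol (add_dim n) (1 / 4 * (1 - \<epsilon>) / real n) (xor_fun (Add n))
        (D_oneway (add_dim n) (1 / 4 * (1 - \<epsilon>) / real n) (xor_fun (Add n)))"
      (is "one_way_protocol _ _ _ ?t")
      unfolding D_oneway_def using \<epsilon> by (intro LeastI[OF one_way_protocol_full]) simp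
    \<comment> \<open>The constant 1/4 keeps the allowed error strictly below the unavoidable
      \<open>1 / (2 * n)\<close>, so any admissible message length is at least \<open>n\<close>,
      hence at least \<open>d\<close>.\<close>
    moreover have "1 / 4 * (1 - \<epsilon>) / real n < 1 / (2 * real n)"
      using \<epsilon> d by (simp add: field_simps add_pos_pos)
    ultimately have "n \<le> ?t"
      using one_way_protocol_Add_error[OF n] by (meson linorder_not_le)
    with d show "d \<le> D_oneway (add_dim n) (1 / 4 * (1 - real d / real n) / real n) (xor_fun (Add n))"
      by (simp add: \<epsilon>_def)
  qed
  then show ?thesis
    by (intro exI[of _ "1 / 4"]) (auto simp: Let_def)
qed

end
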